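(* Consider the leader-follower consensus dynamics $\dot{\mathbf{x}}=-A\mathbf{x}+\mathbf{B}u$ with output $y=C\mathbf{x}$, $C=I\otimes I_k$ (the identity), on a connected graph $\mathcal{G}$ with matrix-valued edge weights in $\mathcal{S}_{++}^k$, leader set $\mathcal{R}$ and set of source nodes $R$. Then its $\mathcal{H}_2$ norm satisfies $$\left(\mathcal{H}_2^{\mathcal{G},\mathbf{B}}\right)^2=\frac12\sum_{s\in R}\mathrm{Tr}\left[\mathbf{Y}_s^s\right]=\frac12\sum_{s\in R}\mathrm{Tr}\left[\rho^{\mathrm{eff}}_{s,\mathcal{R}}\right],$$ where $\mathbf{Y}_s^s$ is the $k\times k$ block of $A^{-1}\mathbf{e}_s$ corresponding to node $s$ and $\rho^{\mathrm{eff}}_{s,\mathcal{R}}$ is the matrix-valued effective resistance from $s$ to the grounded leader set $\mathcal{R}$.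
   Context: $\mathcal{S}_{++}^k$ is the set of real symmetric positive-definite $k\times k$ matrices; $\mathbf{e}_i=e_i\otimes I_k$. Leader-follower setup: $\mathcal{G}$ is a finite connected simple undirected graph with node set $\mathcal{N}$ and edge weights $W_e\in\mathcal{S}_{++}^k$. $\mathcal{R}\subset\mathcal{N}$ is the set of leaders; the others are followers. Each leader is joined by a single edge, of identity weight, to one follower, distinct leaders to distinct followers, and has no other edges. The followers so attached form the set of source nodes $R=\{i_1,\dots,i_m\}$. The Dirichlet Laplacian, indexed by followers in $k\times k$ blocks, is $A=\sum_{e=\{i,j\}}(\mathbf{e}_i-\mathbf{e}_j)W_e(\mathbf{e}_i-\mathbf{e}_j)^{\intercal}+\sum_{i\in R}\mathbf{e}_iW_i\mathbf{e}_i^{\intercal}$, the first sum being over edges between followers and $W_i=I_k$ being the weight of the edge from $i$ to its leader; $A$ is positive definite. The input matrix is $\mathbf{B}=[\mathbf{e}_{i_1}\ \cdots\ \mathbf{e}_{i_m}]$. $\mathcal{H}_2$ norm: for $\dot x=Fx+Bu$, $y=Cx$ with transfer function $G(\sigma)=C(\sigma I-F)^{-1}B$, the squared norm is $\frac{1}{2\pi}\int_{-\infty}^{\infty}\mathrm{Tr}[G(j\omega)^*G(j\omega)]\,d\omega$. Effective resistance to $\mathcal{R}$: regard each edge $e$ as a matrix-valued resistor with conductance $W_e$. Inject a current of intensity $\mathbf{i}\in\mathbb{R}^{k\times k}$ at follower $s$ and ground the leaders: one has node potentials $\mathbf{V}_p\in\mathbb{R}^{k\times k}$ with $\mathbf{V}_p=0$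 for $p\in\mathcal{R}$, and edge currents $\mathbf{I}_e\in\mathbb{R}^{k\times k}$ with $W_e^{-1}\mathbf{I}_e=\mathbf{V}_p-\mathbf{V}_q$ for each edge $e$ oriented from $p$ to $q$, such that the net outflow of current is $\mathbf{i}$ at $s$ and $0$ at every other follower. Then $\rho^{\mathrm{eff}}_{s,\mathcal{R}}$ is the $k\times k$ matrix with $\mathbf{V}_s=\rho^{\mathrm{eff}}_{s,\mathcal{R}}\,\mathbf{i}$ for every $\mathbf{i}$. *)

theory Defs
  imports "HOL-Analysis.Analysis"
begin

text \<open>
  Followers form the finite type \<open>'f\<close> and leaders the finite type \<open>'l\<close>, so that the node
  set is \<open>'f + 'l\<close>: \<open>Inl i\<close> is the follower \<open>i\<close>, \<open>Inr l\<close> the leader \<open>l\<close>. Block matrices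
  over the followers with \<open>k \<times> k\<close> blocks are indexed by pairs in \<open>'f \<times> 'k\<close>. An undirected
  edge is a two-element set of nodes, and \<open>W\<close> assigns to it its matrix weight (values of
  \<open>W\<close> outside the edge set are irrelevant).
\<close>

definition spd :: "real^'k^'k \<Rightarrow> bool" where
  "spd M \<longleftrightarrow> transpose M = M \<and> (\<forall>x. x \<noteq> 0 \<longrightarrow> x \<bullet> (M *v x) > 0)"

definition connected_graph :: "'v set set \<Rightarrow> bool" where
  "connected_graph E \<longleftrightarrow> (\<forall>p q. (p, q) \<in> {(p, q). {p, q} \<in> E}\<^sup>*)"

locale leader_follower =
  fixes E :: "('f::finite + 'l::finite) set set"
    and W :: "('f + 'l) set \<Rightarrow> real^'k^'k"
  assumes simple: "\<And>e. e \<in> E \<Longrightarrow> card e = 2"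
    and connected: "connected_graph E"
    and weights: "\<And>e. e \<in> E \<Longrightarrow> spd (W e)"
    and leader_edge:
      "\<And>l. \<exists>i. {e \<in> E. Inr l \<in> e} = {{Inl i, Inr l}} \<and> W {Inl i, Inr l} = mat 1"
    and leaders_distinct:
      "\<And>i l l'. {Inl i, Inr l} \<in> E \<Longrightarrow> {Inl i, Inr l'} \<in> E \<Longrightarrow> l = l'"

definition source_nodes :: "('f + 'l) set set \<Rightarrow> 'f set" where
  "source_nodes E = {i. \<exists>l. {Inl i, Inr l} \<in> E}"

definition source_of :: "('f + 'l) set set \<Rightarrow> 'l \<Rightarrow> 'f" where
  "source_of E l = (THE i. {Inl i, Inr l} \<in> E)"

definition leader_of :: "('f + 'l) set set \<Rightarrow> 'f \<Rightarrow> 'l" where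
  "leader_of E i = (THE l. {Inl i, Inr l} \<in> E)"

text \<open>The \<open>nk \<times> k\<close> matrix \<open>e\<^sub>i \<otimes> I\<^sub>k\<close>.\<close>

definition blk :: "'f::finite \<Rightarrow> real^'k^('f \<times> 'k)" where
  "blk i = (\<chi> p c. (axis i 1 :: real^'f) $ fst p * (mat 1 :: real^'k^'k) $ snd p $ c)"

definition diag_block :: "'f::finite \<Rightarrow> real^'k^('f \<times> 'k) \<Rightarrow> real^'k^'k" where
  "diag_block s M = (\<chi> a b. M $ (s, a) $ b)"

definition follower_edges :: "('f + 'l) set set \<Rightarrow> ('f + 'l) set set" where
  "follower_edges E = {e \<in> E. e \<subseteq> range Inl}"

definition edge_term :: "'f::finite \<Rightarrow> 'f \<Rightarrow> real^'k^'k \<Rightarrow> real^('f \<times> 'k)^('f \<times> 'k)" where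
  "edge_term i j M = (blk i - blk j) ** M ** transpose (blk i - blk j)"

text \<open>The choice of \<open>(i, j)\<close> below is immaterial, by the following symmetry.\<close>

lemma edge_term_commute: "edge_term i j M = edge_term j i M"
proof -
  have 1: "(blk i - blk j :: real^'k^('f \<times> 'k)) = - (blk j - blk i)" for i j :: "'f::finite"
    by simp
  show ?thesis
    unfolding edge_term_def
    by (subst (1 2) 1)
       (simp add: vec_eq_iff matrix_matrix_mult_def transpose_def sum_negf del: minus_diff_eq)
qed

definition dirichlet_laplacian ::
    "('f::finite + 'l::finite) set set \<Rightarrow> (('f + 'l) set \<Rightarrow> real^'k^'k)
      \<Rightarrow> real^('f \<times> 'k)^('f \<times> 'k)" where
  "dirichlet_laplacian E W =
     (\<Sum>e\<in>follower_edges E.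
        let (i, j) = (SOME (i, j). e = {Inl i, Inl j}) in edge_term i j (W e))
     + (\<Sum>i\<in>source_nodes E.
          blk i ** W {Inl i, Inr (leader_of E i)} ** transpose (blk i))"

text \<open>
  The block columns \<open>e\<^sub>i\<close> of the input matrix, with \<open>i\<close> running through the source nodes,
  are enumerated by the leaders, which are in bijection with the source nodes.
\<close>

definition input_matrix ::
    "('f::finite + 'l::finite) set set \<Rightarrow> real^('l \<times> 'k::finite)^('f \<times> 'k)" where
  "input_matrix E = (\<chi> p q. blk (source_of E (fst q)) $ p $ snd q)"

definition conj_transpose :: "complex^'n^'m \<Rightarrow> complex^'m^'n" where
  "conj_transpose M = (\<chi> i j. cnj (M $ j $ i))"

definition transfer_function ::
    "real^'n^'n \<Rightarrow> real^'m^'n \<Rightarrow> real^'n^'p \<Rightarrow> complex \<Rightarrow> complex^'m^'p" where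
  "transfer_function F B C \<sigma> =
     map_matrix complex_of_real C ** matrix_inv (mat \<sigma> - map_matrix complex_of_real F) ** map_matrix complex_of_real B"

text \<open>The trace below is real and nonnegative, so taking its real part loses nothing.
  As for every Bochner integral, the value is 0 if the integrand is not integrable.\<close>

definition h2_norm :: "real^'n^'n \<Rightarrow> real^'m^'n \<Rightarrow> real^'n^'p \<Rightarrow> real" where
  "h2_norm F B C =
     sqrt (1 / (2 * pi) *
       (LINT \<omega>|lborel.
          Re (trace (conj_transpose (transfer_function F B C (\<i> * complex_of_real \<omega>))
                     ** transfer_function F B C (\<i> * complex_of_real \<omega>)))))"

text \<open>
  \<open>I p q\<close> is the current on the edge \<open>{p, q}\<close> when it is oriented from \<open>p\<close> to \<open>q\<close>. Ohm's
  law for both orientations forces \<open>I q p = - I p q\<close>, so the sum in the last conjunct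
  is the net outflow of current at the follower \<open>p\<close>.
\<close>

definition electrical_flow ::
    "('f::finite + 'l::finite) set set \<Rightarrow> (('f + 'l) set \<Rightarrow> real^'k^'k) \<Rightarrow> 'f
      \<Rightarrow> real^'k^'k \<Rightarrow> ('f + 'l \<Rightarrow> real^'k^'k)
      \<Rightarrow> ('f + 'l \<Rightarrow> 'f + 'l \<Rightarrow> real^'k^'k) \<Rightarrow> bool" where
  "electrical_flow E W s c V I \<longleftrightarrow>
     (\<forall>l. V (Inr l) = 0) \<and>
     (\<forall>p q. {p, q} \<in> E \<longrightarrow> matrix_inv (W {p, q}) ** I p q = V p - V q) \<and>
     (\<forall>p. (\<Sum>q | {Inl p, q} \<in> E. I (Inl p) q) = (if p = s then c else 0))"

definition effective_resistance ::
    "('f::finite + 'l::finite) set set \<Rightarrow> (('f + 'l) set \<Rightarrow> real^'k^'k) \<Rightarrow> 'f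
      \<Rightarrow> real^'k^'k" where
  "effective_resistance E W s =
     (THE \<rho>. \<forall>c. (\<exists>V I. electrical_flow E W s c V I) \<and>
                  (\<forall>V I. electrical_flow E W s c V I \<longrightarrow> V (Inl s) = \<rho> ** c))"

end

theory Submission
  imports Defs "HOL-Probability.Sinc_Integral"
begin

text \<open>
  The Dirichlet Laplacian \<open>A\<close> is symmetric, and it is positive definite because
  \<open>2 x \<bullet> A x\<close> is the sum over all ordered adjacent pairs \<open>(p, q)\<close> of
  \<open>(V p - V q) \<bullet> W (V p - V q)\<close>, where \<open>V\<close> extends \<open>x\<close> by zero to the leaders; if this vanishes,
  then \<open>V\<close> is constant on the connected graph, hence zero. In an orthonormal eigenbasis of \<open>A\<close> the
  integrand of the \<open>H\<^sub>2\<close> norm is a combination of the functions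
  \<open>1 / (\<omega>\<^sup>2 + \<lambda>\<^sup>2)\<close>, whose integrals are \<open>\<pi> / \<lambda>\<close>; so the squared norm is half the trace of
  \<open>B\<^sup>T A\<^sup>-\<^sup>1 B\<close>. Kirchhoff's and Ohm's laws for a current \<open>c\<close> injected at \<open>s\<close> together say
  \<open>A V = e\<^sub>s c\<close>, so the effective resistance is the \<open>(s, s)\<close> block of the inverse of \<open>A\<close>.
\<close>

subsection \<open>Spectral decomposition of self-adjoint maps\<close>

text \<open>The Rayleigh quotient attains its maximum on the compact unit sphere of
  \<open>S\<close>, and a maximiser is an eigenvector. Invariance keeps the residual
  \<open>w = f u - l *\<^sub>R u\<close> inside \<open>S\<close>, where maximality can be tested
  against it. Working in a subspace rather than the whole space prepares the induction on dimension
  below.\<close>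

lemma selfadjoint_eigenvector:
  fixes f :: "'a::euclidean_space \<Rightarrow> 'a"
  assumes "linear f" and selfadjoint: "\<And>x y. x \<bullet> f y = f x \<bullet> y"
    and "subspace S" and invariant: "f ` S \<subseteq> S" and "S \<noteq> {0}"
  obtains u where "u \<in> S" "norm u = 1" "f u = (u \<bullet> f u) *\<^sub>R u"
proof -
  interpret linear f by fact
  let ?K = "S \<inter> sphere 0 1"
  have "compact ?K"
    by (intro closed_Int_compact closed_subspace \<open>subspace S\<close>) auto
  moreover have "?K \<noteq> {}"
  proof -
    obtain x where "x \<in> S" "x \<noteq> 0"
      using \<open>S \<noteq> {0}\<close> subspace_0[OF \<open>subspace S\<close>] by blast
    then have "sgn x \<in> ?K"
      by (simp add: sgn_div_norm subspace_scale \<open>subspace S\<close>)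
    then show ?thesis by blast
  qed
  moreover have "continuous_on ?K (\<lambda>x. x \<bullet> f x)"
    using \<open>linear f\<close>
    by (intro continuous_intros linear_continuous_on) (simp add: linear_conv_bounded_linear)
  ultimately have "\<exists>u\<in>?K. \<forall>x\<in>?K. x \<bullet> f x \<le> u \<bullet> f u"
    by (rule continuous_attains_sup)
  then obtain u where u: "u \<in> ?K" and max: "\<And>x. x \<in> ?K \<Longrightarrow> x \<bullet> f x \<le> u \<bullet> f u"
    by blast
  define l where "l = u \<bullet> f u"
  have uS: "u \<in> S" and u1: "u \<bullet> u = 1"
    using u by (auto simp: dot_square_norm)
  have rayleigh: "x \<bullet> f x \<le> l * (x \<bullet> x)" if "x \<in> S" for x
  proof (cases "x = 0")
    case False
    then have "sgn x \<in> ?K"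
      using that by (simp add: sgn_div_norm subspace_scale \<open>subspace S\<close>)
    then have "sgn x \<bullet> f (sgn x) \<le> l"
      using max l_def by blast
    then show ?thesis
      using False by (simp add: sgn_div_norm scale dot_square_norm power2_eq_square field_simps)
  qed (simp add: zero)
  define w where "w = f u - l *\<^sub>R u"
  have wS: "w \<in> S"
    using uS invariant \<open>subspace S\<close> unfolding w_def
    by (intro subspace_diff subspace_scale) auto
  define c where "c = l * (w \<bullet> w) - w \<bullet> f w"
  \<comment> \<open>Expand the Rayleigh inequality at \<open>u + t w\<close>; its linear term in \<open>t\<close> forces \<open>w = 0\<close>.\<close>
  have bound: "2 * t * (w \<bullet> w) \<le> t\<^sup>2 * c" for t
  proof -
    have "u + t *\<^sub>R w \<in> S"
      using uS wS \<open>subspace S\<close> by (intro subspace_add subspace_scale)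
    note rayleigh[OF this]
    moreover have "f u = w + l *\<^sub>R u"
      by (simp add: w_def)
    moreover have "u \<bullet> f w = w \<bullet> f u"
      by (metis selfadjoint inner_commute)
    moreover have "w \<bullet> f u = w \<bullet> w + l * (w \<bullet> u)"
      using \<open>f u = w + l *\<^sub>R u\<close> by (simp add: inner_add_right)
    moreover have "u \<bullet> w = w \<bullet> u" "u \<bullet> f u = l"
      by (simp_all add: inner_commute l_def)
    ultimately show ?thesis
      using u1 by (simp add: add scale inner_add_left inner_add_right c_def algebra_simps power2_eq_square)
  qed
  have "w = 0"
  proof (rule ccontr)
    assume "w \<noteq> 0"
    then have a: "0 < w \<bullet> w" by simp
    \<comment> \<open>This \<open>t\<close> makes the quadratic term at most half of the linear one;
      the \<open>+ 1\<close> keeps the denominator positive when \<open>c = 0\<close>.\<close>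
    define t where "t = (w \<bullet> w) / (\<bar>c\<bar> + 1)"
    have "0 < t" using a by (simp add: t_def)
    have "t * (2 * (w \<bullet> w)) \<le> t * (t * c)"
      using bound[of t] by (simp add: power2_eq_square mult_ac)
    then have "2 * (w \<bullet> w) \<le> t * c"
      using \<open>0 < t\<close> by simp
    also have "\<dots> \<le> t * (\<bar>c\<bar> + 1)"
      using \<open>0 < t\<close> by (intro mult_left_mono) auto
    also have "\<dots> = w \<bullet> w" by (simp add: t_def)
    finally show False using a by simp
  qed
  then show ?thesis
    using that[OF uS] u by (simp add: w_def l_def)
qed

text \<open>Deflation: split off one unit eigenvector \<open>u\<close> and recurse on its orthogonal
  complement \<open>T\<close> within \<open>S\<close>. Self-adjointness makes \<open>T\<close>
  invariant, since \<open>u \<bullet> f x = f u \<bullet> x\<close> is a multiple of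
  \<open>u \<bullet> x\<close>. Completeness is recorded as the expansion formula, the form in which
  it is used later.\<close>

lemma selfadjoint_orthonormal_eigenvectors:
  fixes f :: "'a::euclidean_space \<Rightarrow> 'a"
  assumes "linear f" and selfadjoint: "\<And>x y. x \<bullet> f y = f x \<bullet> y"
    and "subspace S" and "f ` S \<subseteq> S"
  shows "\<exists>U. finite U \<and> U \<subseteq> S \<and> (\<forall>u\<in>U. \<forall>v\<in>U. u \<bullet> v = (if u = v then 1 else 0))
    \<and> (\<forall>u\<in>U. f u = (u \<bullet> f u) *\<^sub>R u) \<and> (\<forall>x\<in>S. (\<Sum>u\<in>U. (u \<bullet> x) *\<^sub>R u) = x)"
  using assms(3,4)
proof (induction "dim S" arbitrary: S rule: less_induct)
  case less
  show ?case
  proof (cases "S = {0}")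
    case True
    then show ?thesis by (intro exI[of _ "{}"]) simp
  next
    case False
    then obtain u where u: "u \<in> S" "norm u = 1" "f u = (u \<bullet> f u) *\<^sub>R u"
      using selfadjoint_eigenvector[OF \<open>linear f\<close> selfadjoint less.prems] by metis
    have u1: "u \<bullet> u = 1"
      using u(2) by (simp add: dot_square_norm)
    define T where "T = S \<inter> {x. u \<bullet> x = 0}"
    have T: "subspace T"
      unfolding T_def by (intro subspace_inter less.prems subspace_hyperplane)
    have "f x \<in> T" if "x \<in> T" for x
    proof -
      have "u \<bullet> f x = ((u \<bullet> f u) *\<^sub>R u) \<bullet> x"
        using selfadjoint u(3) by metis
      then show ?thesis
        using that less.prems(2) by (auto simp: T_def)
    qed
    moreover have "dim T < dim S"
    proof (rule dim_psubset)
      have "u \<notin> T" using u1 by (simp add: T_def)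
      then have "T \<subset> S" using u(1) by (auto simp only: T_def)
      then show "span T \<subset> span S"
        using T less.prems by (simp add: span_eq_iff[THEN iffD2])
    qed
    ultimately obtain U where U: "finite U" "U \<subseteq> T"
        "\<forall>u\<in>U. \<forall>v\<in>U. u \<bullet> v = (if u = v then 1 else 0)"
        "\<forall>u\<in>U. f u = (u \<bullet> f u) *\<^sub>R u" "\<forall>x\<in>T. (\<Sum>u\<in>U. (u \<bullet> x) *\<^sub>R u) = x"
      using less.hyps[of T] T by blast
    have orth: "u \<bullet> v = 0" if "v \<in> U" for v
      using that U(2) by (auto simp: T_def)
    then have orth': "v \<bullet> u = 0" if "v \<in> U" for v
      using that by (metis inner_commute)
    have "u \<notin> U" using u1 orth by force
    have "(\<Sum>v\<in>insert u U. (v \<bullet> x) *\<^sub>R v) = x" if "x \<in> S" for x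
    proof -
      \<comment> \<open>Removing the \<open>u\<close>-component lands in \<open>T\<close> and leaves
        the coefficients along \<open>U\<close> unchanged, because \<open>U\<close> is orthogonal to
        \<open>u\<close>.\<close>
      let ?y = "x - (u \<bullet> x) *\<^sub>R u"
      have "?y \<in> T"
        using that u(1) u1 less.prems(1)
        by (simp add: T_def subspace_diff subspace_scale inner_diff_right)
      then have "?y = (\<Sum>v\<in>U. (v \<bullet> ?y) *\<^sub>R v)"
        using U(5) by simp
      also have "\<dots> = (\<Sum>v\<in>U. (v \<bullet> x) *\<^sub>R v)"
        using orth' by (intro sum.cong) (auto simp: inner_diff_right)
      finally show ?thesis
        using \<open>finite U\<close> \<open>u \<notin> U\<close> by (simp add: algebra_simps)
    qed
    moreover have "\<forall>v\<in>insert u U. f v = (v \<bullet> f v) *\<^sub>R v"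
      using U(4) u(3) by blast
    moreover have "insert u U \<subseteq> S"
      using U(2) u(1) by (auto simp only: T_def)
    moreover have "\<forall>v\<in>insert u U. \<forall>w\<in>insert u U. v \<bullet> w = (if v = w then 1 else 0)"
      using U(3) u1 orth orth' \<open>u \<notin> U\<close> by auto
    ultimately show ?thesis
      using U(1) by (intro exI[of _ "insert u U"]) blast
  qed
qed

lemma matrix_inv_eqI:
  assumes "A ** B = mat 1" "B ** A = mat 1"
  shows "matrix_inv A = B"
proof -
  have "A ** matrix_inv A = mat 1 \<and> matrix_inv A ** A = mat 1"
    unfolding matrix_inv_def by (rule someI[of _ B]) (use assms in simp)
  then show ?thesis
    by (metis assms(2) matrix_mul_assoc matrix_mul_lid matrix_mul_rid)
qed

subsection \<open>The \<open>H\<^sub>2\<close> norm of a symmetric system\<close>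

text \<open>Rescaling by \<open>1 / l\<close> reduces this to the arctangent integral. The
  \<open>has_bochner_integral\<close> form carries integrability along with the value, so the
  default value 0 of the integral in \<open>h2_norm\<close> is never met.\<close>

lemma has_bochner_integral_inverse_square_plus_square:
  fixes l :: real
  assumes "0 < l"
  shows "has_bochner_integral lborel (\<lambda>x. 1 / (x\<^sup>2 + l\<^sup>2)) (pi / l)"
proof -
  have "integrable lborel (\<lambda>x. inverse (1 + x\<^sup>2) :: real)"
    using integrable_inverse_1_plus_square by (simp add: set_integrable_def)
  moreover have "(LBINT x. inverse (1 + x\<^sup>2)) = pi"
    using LBINT_inverse_1_plus_square
    by (simp add: interval_lebesgue_integral_def set_lebesgue_integral_def)
  ultimately have "has_bochner_integral lborel (\<lambda>x::real. inverse (1 + x\<^sup>2)) pi"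
    by (simp add: has_bochner_integral_iff)
  then have "has_bochner_integral lborel (\<lambda>x::real. inverse (1 + (0 + (1 / l) * x)\<^sup>2)) (pi /\<^sub>R \<bar>1 / l\<bar>)"
    using assms by (subst lborel_has_bochner_integral_real_affine_iff[symmetric]) auto
  then have "has_bochner_integral lborel (\<lambda>x::real. (1 / l\<^sup>2) * inverse (1 + (0 + (1 / l) * x)\<^sup>2))
      ((1 / l\<^sup>2) * (pi /\<^sub>R \<bar>1 / l\<bar>))"
    by (intro has_bochner_integral_mult_right)
  moreover have "(1 / l\<^sup>2) * inverse (1 + (0 + (1 / l) * x)\<^sup>2) = 1 / (x\<^sup>2 + l\<^sup>2)" for x
    using assms by (simp add: divide_simps power2_eq_square)
  moreover have "(1 / l\<^sup>2) * (pi /\<^sub>R \<bar>1 / l\<bar>) = pi / l"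
    using assms by (simp add: field_simps power2_eq_square)
  ultimately show ?thesis by simp
qed

text \<open>Functional calculus: the sum of \<open>g u\<close> times the projection onto
  \<open>u\<close>. The scalar field is left open because the same real eigenbasis serves the real
  matrix \<open>A\<close> and its complex resolvent; \<open>g\<close> takes eigenvectors instead of
  eigenvalues, so repeated eigenvalues need no grouping.\<close>

definition spectral_matrix :: "(real^'n) set \<Rightarrow> (real^'n \<Rightarrow> 'a::real_field) \<Rightarrow> 'a^'n^'n" where
  "spectral_matrix U g = (\<chi> i j. \<Sum>u\<in>U. g u * of_real (u $ i * u $ j))"

locale orthonormal_basis =
  fixes U :: "(real^'n) set"
  assumes finite: "finite U"
    and orthonormal: "\<And>u v. u \<in> U \<Longrightarrow> v \<in> U \<Longrightarrow> u \<bullet> v = (if u = v then 1 else 0)"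
    and expansion: "\<And>x. (\<Sum>u\<in>U. (u \<bullet> x) *\<^sub>R u) = x"
begin

text \<open>Exchanging the sums turns the inner one into \<open>u \<bullet> v\<close>, so
  orthonormality leaves only the diagonal terms.\<close>

lemma spectral_matrix_mult:
  "spectral_matrix U g ** spectral_matrix U h = spectral_matrix U (\<lambda>u. g u * h u)"
proof -
  have "(\<Sum>k\<in>UNIV. (\<Sum>u\<in>U. g u * of_real (u $ i * u $ k)) * (\<Sum>v\<in>U. h v * of_real (v $ k * v $ j)))
      = (\<Sum>u\<in>U. g u * h u * of_real (u $ i * u $ j))" for i j
  proof -
    have "(\<Sum>k\<in>UNIV. (\<Sum>u\<in>U. g u * of_real (u $ i * u $ k)) * (\<Sum>v\<in>U. h v * of_real (v $ k * v $ j)))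
      = (\<Sum>k\<in>UNIV. \<Sum>u\<in>U. \<Sum>v\<in>U. g u * h v * of_real (u $ i * v $ j) * of_real (u $ k * v $ k))"
      by (simp add: sum_product mult_ac)
    also have "\<dots> = (\<Sum>u\<in>U. \<Sum>v\<in>U. \<Sum>k\<in>UNIV. g u * h v * of_real (u $ i * v $ j) * of_real (u $ k * v $ k))"
      by (subst sum.swap, intro sum.cong refl, subst sum.swap, rule refl)
    also have "\<dots> = (\<Sum>u\<in>U. \<Sum>v\<in>U. g u * h v * of_real (u $ i * v $ j) * of_real (u \<bullet> v))"
      by (simp add: inner_vec_def sum_distrib_left)
    also have "\<dots> = (\<Sum>u\<in>U. \<Sum>v\<in>U. if u = v then g u * h v * of_real (u $ i * v $ j) else 0)"
      by (intro sum.cong refl) (simp add: orthonormal)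
    finally show ?thesis
      by (simp add: finite)
  qed
  then show ?thesis
    by (simp add: spectral_matrix_def matrix_matrix_mult_def)
qed

text \<open>Resolution of the identity: the expansion applied to the standard basis vectors.\<close>

lemma spectral_matrix_const: "spectral_matrix U (\<lambda>_. c) = mat c"
proof -
  have "(\<Sum>u\<in>U. u $ i * u $ j) = (if i = j then 1 else 0)" for i j
  proof -
    have "(\<Sum>u\<in>U. (u \<bullet> axis j 1) *\<^sub>R u) $ i = axis j 1 $ i"
      by (simp add: expansion)
    then have "(\<Sum>u\<in>U. u $ i * u $ j) = axis j 1 $ i"
      by (simp add: inner_axis mult.commute)
    then show ?thesis
      by (simp add: axis_def)
  qed
  then have "(\<Sum>u\<in>U. c * of_real (u $ i * u $ j)) = (if i = j then c else 0)" for i j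
    by (simp only: sum_distrib_left[symmetric] of_real_sum[symmetric]) simp
  then show ?thesis
    by (simp add: spectral_matrix_def mat_def)
qed

lemma matrix_inv_spectral_matrix:
  assumes "\<And>u. u \<in> U \<Longrightarrow> g u \<noteq> 0"
  shows "matrix_inv (spectral_matrix U g) = spectral_matrix U (\<lambda>u. 1 / g u)"
proof (rule matrix_inv_eqI)
  have "spectral_matrix U (\<lambda>u. g u * (1 / g u)) = spectral_matrix U (\<lambda>_. 1)"
       "spectral_matrix U (\<lambda>u. 1 / g u * g u) = spectral_matrix U (\<lambda>_. 1)"
    unfolding spectral_matrix_def using assms by simp_all
  then show "spectral_matrix U g ** spectral_matrix U (\<lambda>u. 1 / g u) = mat 1"
     "spectral_matrix U (\<lambda>u. 1 / g u) ** spectral_matrix U g = mat 1"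
    by (simp_all only: spectral_matrix_mult spectral_matrix_const)
qed

end

section \<open>Traces of spectral matrices and the frequency integral\<close>

lemma conj_transpose_mult: "conj_transpose (A ** B) = conj_transpose B ** conj_transpose A"
  by (simp add: conj_transpose_def matrix_matrix_mult_def vec_eq_iff mult.commute)

lemma conj_transpose_spectral_matrix:
  "conj_transpose (spectral_matrix U g) = spectral_matrix U (\<lambda>u. cnj (g u))"
  by (simp add: conj_transpose_def spectral_matrix_def vec_eq_iff mult.commute)

text \<open>The trace decouples into modes: \<open>u\<close> is weighted by the squared norm of its
  image under the transpose of \<open>B\<close>. A plain transpose suffices in the complex case too,
  as \<open>B\<close> has real entries.\<close>

lemma (in orthonormal_basis) trace_spectral_matrix:
  fixes B :: "real^'m^'n" and g :: "real^'n \<Rightarrow> 'a::real_field"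
  shows "trace (transpose (map_matrix of_real B) ** spectral_matrix U g ** map_matrix of_real B)
    = (\<Sum>u\<in>U. g u * of_real (\<Sum>q\<in>UNIV. (\<Sum>i\<in>UNIV. u $ i * B $ i $ q)\<^sup>2))"
proof -
  have "(\<Sum>j\<in>UNIV. (\<Sum>i\<in>UNIV. of_real (B $ i $ q) * (\<Sum>u\<in>U. g u * of_real (u $ i * u $ j))) * of_real (B $ j $ q))
     = (\<Sum>u\<in>U. g u * of_real ((\<Sum>i\<in>UNIV. u $ i * B $ i $ q)\<^sup>2))" for q
  proof -
    have "(\<Sum>j\<in>UNIV. (\<Sum>i\<in>UNIV. of_real (B $ i $ q) * (\<Sum>u\<in>U. g u * of_real (u $ i * u $ j))) * of_real (B $ j $ q))
       = (\<Sum>j\<in>UNIV. \<Sum>i\<in>UNIV. \<Sum>u\<in>U. g u * of_real (u $ j * B $ j $ q * (u $ i * B $ i $ q)))"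
      by (simp add: sum_distrib_left sum_distrib_right mult_ac)
    also have "\<dots> = (\<Sum>u\<in>U. \<Sum>j\<in>UNIV. \<Sum>i\<in>UNIV. g u * of_real (u $ j * B $ j $ q * (u $ i * B $ i $ q)))"
      by (subst sum.swap[of _ U], intro sum.cong refl sum.swap)
    also have "\<dots> = (\<Sum>u\<in>U. g u * of_real ((\<Sum>i\<in>UNIV. u $ i * B $ i $ q)\<^sup>2))"
      by (simp only: power2_eq_square sum_product) (simp only: of_real_sum sum_distrib_left)
    finally show ?thesis .
  qed
  then have "trace (transpose (map_matrix of_real B) ** spectral_matrix U g ** map_matrix of_real B)
    = (\<Sum>q\<in>UNIV. \<Sum>u\<in>U. g u * of_real ((\<Sum>i\<in>UNIV. u $ i * B $ i $ q)\<^sup>2))"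
    by (simp add: trace_def spectral_matrix_def matrix_matrix_mult_def transpose_def)
  also have "\<dots> = (\<Sum>u\<in>U. g u * of_real (\<Sum>q\<in>UNIV. (\<Sum>i\<in>UNIV. u $ i * B $ i $ q)\<^sup>2))"
    by (subst sum.swap) (simp add: sum_distrib_left)
  finally show ?thesis .
qed

lemma map_matrix_of_real_one: "map_matrix of_real (mat 1) = mat 1"
  by (simp add: vec_eq_iff mat_def)

lemma conj_transpose_of_real:
  "conj_transpose (map_matrix complex_of_real B) = transpose (map_matrix complex_of_real B)"
  by (simp add: vec_eq_iff conj_transpose_def transpose_def)

text \<open>The right-hand side is the trace form of the observability Gramian, which for full state
  output and symmetric \<open>A\<close> is half the inverse of \<open>A\<close>. It is reached mode
  by mode in the frequency domain, with no Lyapunov equation.\<close>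

lemma h2_norm_symmetric:
  fixes A :: "real^'n^'n" and B :: "real^'m^'n"
  assumes symmetric: "transpose A = A" and pos: "\<And>x. x \<noteq> 0 \<Longrightarrow> 0 < x \<bullet> (A *v x)"
  shows "(h2_norm (- A) B (mat 1 :: real^'n^'n))\<^sup>2 = 1 / 2 * trace (transpose B ** matrix_inv A ** B)"
proof -
  have sa: "x \<bullet> (A *v y) = (A *v x) \<bullet> y" for x y
    by (metis dot_lmul_matrix symmetric vector_transpose_matrix)
  obtain U where U: "finite U" "\<forall>u\<in>U. \<forall>v\<in>U. u \<bullet> v = (if u = v then 1 else 0)"
      "\<forall>u\<in>U. A *v u = (u \<bullet> (A *v u)) *\<^sub>R u" "\<forall>x. (\<Sum>u\<in>U. (u \<bullet> x) *\<^sub>R u) = x"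
    using selfadjoint_orthonormal_eigenvectors[of "(*v) A" UNIV] sa by auto
  interpret orthonormal_basis U
    by unfold_locales (use U in auto)
  define l where "l u = u \<bullet> (A *v u)" for u
  have l_pos: "0 < l u" if "u \<in> U" for u
    unfolding l_def using that orthonormal[OF that that] by (intro pos) auto
  have eig: "A *v u = l u *\<^sub>R u" if "u \<in> U" for u
    using that U(3) l_def by metis
  have A: "A = spectral_matrix U l"
  proof -
    have "A $ i $ j = (\<Sum>u\<in>U. l u * (u $ i * u $ j))" for i j
    proof -
      have "A $ i $ j = (A *v axis j 1) $ i"
        by (simp add: matrix_vector_mult_basis column_def)
      also have "\<dots> = (A *v (\<Sum>u\<in>U. (u \<bullet> axis j 1) *\<^sub>R u)) $ i"
        by (simp only: expansion)
      also have "\<dots> = (\<Sum>u\<in>U. (u \<bullet> axis j 1) *\<^sub>R (A *v u)) $ i"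
        by (simp add: linear_sum[OF matrix_vector_mul_linear] matrix_vector_mult_scaleR)
      finally show ?thesis
        by (simp add: eig inner_axis mult_ac)
    qed
    then show ?thesis
      by (simp add: spectral_matrix_def vec_eq_iff)
  qed
  define b where "b u = (\<Sum>q\<in>UNIV. (\<Sum>i\<in>UNIV. u $ i * B $ i $ q)\<^sup>2)" for u
  have "Re (trace (conj_transpose (transfer_function (- A) B (mat 1 :: real^'n^'n) (\<i> * complex_of_real w))
       ** transfer_function (- A) B (mat 1 :: real^'n^'n) (\<i> * complex_of_real w)))
     = (\<Sum>u\<in>U. b u * (1 / (w\<^sup>2 + (l u)\<^sup>2)))" for w
  proof -
    let ?B = "map_matrix complex_of_real B" and ?g = "\<lambda>u. \<i> * complex_of_real w + of_real (l u)"
    \<comment> \<open>The real part \<open>l u\<close> is positive, so the resolvent exists on the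
      whole imaginary axis.\<close>
    have nz: "?g u \<noteq> 0" if "u \<in> U" for u
      using l_pos[OF that] by (simp add: complex_eq_iff)
    have "mat (\<i> * complex_of_real w) - map_matrix complex_of_real (- A)
        = spectral_matrix U (\<lambda>_. \<i> * complex_of_real w) + spectral_matrix U (\<lambda>u. of_real (l u))"
      unfolding spectral_matrix_const by (simp add: A spectral_matrix_def vec_eq_iff)
    also have "\<dots> = spectral_matrix U ?g"
      by (simp add: spectral_matrix_def vec_eq_iff algebra_simps sum.distrib)
    finally have G: "transfer_function (- A) B (mat 1 :: real^'n^'n) (\<i> * complex_of_real w)
        = spectral_matrix U (\<lambda>u. 1 / ?g u) ** ?B"
      by (simp add: transfer_function_def matrix_inv_spectral_matrix[OF nz] map_matrix_of_real_one)
    have "cnj (1 / ?g u) * (1 / ?g u) = of_real (1 / (w\<^sup>2 + (l u)\<^sup>2))" if "u \<in> U" for u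
    proof -
      have "cnj (?g u) * ?g u = of_real (w\<^sup>2 + (l u)\<^sup>2)"
        by (simp add: complex_eq_iff power2_eq_square)
      then show ?thesis
        by simp
    qed
    then have "spectral_matrix U (\<lambda>u. cnj (1 / ?g u) * (1 / ?g u))
       = spectral_matrix U (\<lambda>u. complex_of_real (1 / (w\<^sup>2 + (l u)\<^sup>2)))"
      unfolding spectral_matrix_def by simp
    then have "conj_transpose (spectral_matrix U (\<lambda>u. 1 / ?g u) ** ?B) ** (spectral_matrix U (\<lambda>u. 1 / ?g u) ** ?B)
       = transpose ?B ** spectral_matrix U (\<lambda>u. of_real (1 / (w\<^sup>2 + (l u)\<^sup>2))) ** ?B"
      by (simp only: conj_transpose_mult conj_transpose_spectral_matrix conj_transpose_of_real
          matrix_mul_assoc[symmetric] spectral_matrix_mult)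
         (simp only: matrix_mul_assoc spectral_matrix_mult)
    then show ?thesis
      unfolding G by (simp add: trace_spectral_matrix b_def mult.commute flip: of_real_mult of_real_sum)
  qed
  moreover have "has_bochner_integral lborel (\<lambda>w. \<Sum>u\<in>U. b u * (1 / (w\<^sup>2 + (l u)\<^sup>2))) (\<Sum>u\<in>U. b u * (pi / l u))"
    by (intro has_bochner_integral_sum has_bochner_integral_mult_right
        has_bochner_integral_inverse_square_plus_square l_pos)
  ultimately have h2: "h2_norm (- A) B (mat 1 :: real^'n^'n) = sqrt (1 / (2 * pi) * (\<Sum>u\<in>U. b u * (pi / l u)))"
    unfolding h2_norm_def by (simp add: has_bochner_integral_integral_eq)
  \<comment> \<open>Nonnegativity lets squaring undo the \<open>sqrt\<close> in
    \<open>h2_norm\<close>.\<close>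
  have "0 \<le> (\<Sum>u\<in>U. b u * (pi / l u))"
    unfolding b_def by (intro sum_nonneg mult_nonneg_nonneg divide_nonneg_pos l_pos) auto
  then have "(h2_norm (- A) B (mat 1 :: real^'n^'n))\<^sup>2 = 1 / (2 * pi) * (\<Sum>u\<in>U. b u * (pi / l u))"
    unfolding h2 by simp
  also have "\<dots> = 1 / 2 * (\<Sum>u\<in>U. 1 / l u * b u)"
    by (simp add: sum_distrib_left field_simps)
  also have "(\<Sum>u\<in>U. 1 / l u * b u) = trace (transpose B ** matrix_inv A ** B)"
  proof -
    have "matrix_inv A = spectral_matrix U (\<lambda>u. 1 / l u)"
      unfolding A using l_pos by (intro matrix_inv_spectral_matrix) force
    \<comment> \<open>Over the reals the embedding is the identity, so the trace formula used for
      complex scalars applies again.\<close>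
    moreover have "map_matrix of_real B = B"
      by (simp add: map_matrix_def)
    ultimately show ?thesis
      using trace_spectral_matrix[of B "\<lambda>u. 1 / l u"] by (simp add: b_def)
  qed
  finally show ?thesis .
qed

section \<open>Matrix algebra and invertibility of positive-definite matrices\<close>

lemma sum_matrix_vector_mult: "(\<Sum>i\<in>S. M i) *v x = (\<Sum>i\<in>S. M i *v x)"
  for M :: "'i \<Rightarrow> real^'n^'m"
  by (induction S rule: infinite_finite_induct) (simp_all add: matrix_vector_mult_add_rdistrib)

lemma transpose_sum: "transpose (\<Sum>i\<in>S. M i) = (\<Sum>i\<in>S. transpose (M i))"
  for M :: "'i \<Rightarrow> real^'n^'m"
  by (simp add: vec_eq_iff transpose_def)

lemma transpose_diff: "transpose (M - N) = transpose M - transpose N"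
  for M N :: "real^'n^'m"
  by (simp add: vec_eq_iff transpose_def)

text \<open>Positivity excludes a kernel, and a left inverse of a square matrix is two-sided. This
  serves both the edge weights and the Dirichlet Laplacian itself.\<close>

lemma spd_invertible:
  assumes "spd M"
  shows "M ** matrix_inv M = mat 1" "matrix_inv M ** M = mat 1"
proof -
  have "x = 0" if "M *v x = 0" for x
    using assms that unfolding spd_def by (metis inner_zero_right less_irrefl)
  then obtain N where "N ** M = mat 1"
    using matrix_left_invertible_ker by blast
  then have "M ** N = mat 1 \<and> N ** M = mat 1"
    using matrix_left_right_inverse by blast
  then have "M ** matrix_inv M = mat 1 \<and> matrix_inv M ** M = mat 1"
    unfolding matrix_inv_def by (rule someI)
  then show "M ** matrix_inv M = mat 1" "matrix_inv M ** M = mat 1"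
    by blast+
qed

subsection \<open>The Dirichlet Laplacian\<close>

lemma blk_nth: "blk i $ (r, a) $ c = (if r = i \<and> a = c then 1 else 0)"
  by (simp add: blk_def mat_def axis_def)

lemma sum_pair_UNIV: "(\<Sum>p\<in>UNIV. f p) = (\<Sum>r\<in>UNIV. \<Sum>a\<in>UNIV. f (r, a))"
  for f :: "'a::finite \<times> 'b::finite \<Rightarrow> 'c::comm_monoid_add"
  by (simp add: sum.cartesian_product flip: UNIV_Times_UNIV)

lemma matrix_mult_blk_nth: "(M ** blk s) $ p $ c = M $ p $ (s, c)"
proof -
  \<comment> \<open>Nested conditionals, one per index, let each sum collapse separately.\<close>
  have "(M ** blk s) $ p $ c = (\<Sum>r\<in>UNIV. \<Sum>a\<in>UNIV. if r = s then if a = c then M $ p $ (r, a) else 0 else 0)"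
    by (simp add: matrix_matrix_mult_def sum_pair_UNIV blk_nth, intro sum.cong refl) auto
  also have "\<dots> = (\<Sum>r\<in>UNIV. if r = s then \<Sum>a\<in>UNIV. if a = c then M $ p $ (r, a) else 0 else 0)"
    by (intro sum.cong refl) simp
  finally show ?thesis by simp
qed

lemma blk_mult_vec_nth: "(blk i *v y) $ (r, a) = (if r = i then y $ a else 0)"
proof -
  have "(blk i *v y) $ (r, a) = (\<Sum>c\<in>UNIV. if a = c then if r = i then y $ a else 0 else 0)"
    unfolding matrix_vector_mult_def vec_lambda_beta by (intro sum.cong refl) (auto simp: blk_nth)
  then show ?thesis by simp
qed

lemma blk_mult_nth: "(blk i ** M) $ (r, a) $ c = (if r = i then M $ a $ c else 0)"
  using blk_mult_vec_nth[of i "column c M" r a]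
  by (simp add: matrix_matrix_mult_def matrix_vector_mult_def column_def)

text \<open>Grounding the leaders at 0 lets follower and leader edges be treated alike in the sums
  over neighbours.\<close>

definition potential :: "real^('f::finite \<times> 'k::finite) \<Rightarrow> 'f + 'l \<Rightarrow> real^'k" where
  "potential x = case_sum (\<lambda>i. \<chi> a. x $ (i, a)) (\<lambda>_. 0)"

lemma potential_simps [simp]:
  "potential x (Inl i) = (\<chi> a. x $ (i, a))" "potential x (Inr l) = 0"
  by (simp_all add: potential_def)

lemma transpose_blk_mult_vec: "transpose (blk i) *v x = (\<chi> a. x $ (i, a))"
proof -
  have "(transpose (blk i) *v x) $ c = x $ (i, c)" for c
  proof -
    have "(transpose (blk i) *v x) $ c
      = (\<Sum>r\<in>UNIV. \<Sum>a\<in>UNIV. if r = i then if a = c then x $ (r, a) else 0 else 0)"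
      by (simp add: matrix_vector_mult_def transpose_def sum_pair_UNIV blk_nth, intro sum.cong refl) auto
    also have "\<dots> = (\<Sum>r\<in>UNIV. if r = i then \<Sum>a\<in>UNIV. if a = c then x $ (r, a) else 0 else 0)"
      by (intro sum.cong refl) simp
    finally show ?thesis by simp
  qed
  then show ?thesis by (simp add: vec_eq_iff)
qed

lemma edge_term_mult_vec:
  "edge_term i j M *v x
    = (blk i - blk j) *v (M *v ((\<chi> a. x $ (i, a)) - (\<chi> a. x $ (j, a))))"
proof -
  have "transpose (blk i - blk j) *v x = (\<chi> a. x $ (i, a)) - (\<chi> a. x $ (j, a))"
    by (simp only: transpose_blk_mult_vec matrix_vector_mult_diff_rdistrib transpose_diff)
  then show ?thesis
    by (simp add: edge_term_def flip: matrix_vector_mul_assoc)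
qed

lemma transpose_edge_term: "transpose (edge_term i j M) = edge_term i j (transpose M)"
  by (simp add: edge_term_def matrix_transpose_mul matrix_mul_assoc)

section \<open>Leaders, source nodes and the choice of edge orientation\<close>

context leader_follower
begin

lemma edge_neq: "{p, q} \<in> E \<Longrightarrow> p \<noteq> q"
  using simple[of "{p, q}"] by auto

lemma leader_neighbour:
  obtains i where "{Inl i, Inr l} \<in> E" "W {Inl i, Inr l} = mat 1"
    "\<And>e. e \<in> E \<Longrightarrow> Inr l \<in> e \<Longrightarrow> e = {Inl i, Inr l}"
  using leader_edge[of l] by blast

lemma leader_neighbour_unique:
  assumes "{Inl i, Inr l} \<in> E" "{Inl j, Inr l} \<in> E"
  shows "i = j"
proof -
  obtain k where "\<And>e. e \<in> E \<Longrightarrow> Inr l \<in> e \<Longrightarrow> e = {Inl k, Inr l}"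
    using leader_neighbour by metis
  from this[OF assms(1)] this[OF assms(2)] show ?thesis
    by (auto simp: doubleton_eq_iff)
qed

lemma source_of_edge: "{Inl (source_of E l), Inr l} \<in> E"
  unfolding source_of_def
  by (rule theI') (metis leader_neighbour leader_neighbour_unique)

lemma source_of_eqI: "{Inl i, Inr l} \<in> E \<Longrightarrow> source_of E l = i"
  using leader_neighbour_unique source_of_edge by blast

lemma leader_of_eqI: "{Inl i, Inr l} \<in> E \<Longrightarrow> leader_of E i = l"
  unfolding leader_of_def using leaders_distinct by blast

text \<open>Needed to turn a trace over input columns, enumerated by leaders, into a sum over source
  nodes. Injectivity is \<open>leaders_distinct\<close>.\<close>

lemma bij_betw_source_of: "bij_betw (source_of E) UNIV (source_nodes E)"
  unfolding bij_betw_def source_nodes_def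
proof safe
  show "inj (source_of E)"
    using source_of_edge leaders_distinct by (metis injI)
  show "\<exists>l'. {Inl (source_of E l), Inr l'} \<in> E" for l
    using source_of_edge by blast
  show "i \<in> range (source_of E)" if "{Inl i, Inr l} \<in> E" for i l
    using source_of_eqI[OF that] by blast
qed

text \<open>The choice operator may return either orientation of the edge;
  \<open>edge_term_commute\<close> makes both agree.\<close>

lemma edge_choice:
  assumes "{Inl r, Inl q} \<in> E"
  shows "(let (i, j) = (SOME (i, j). {Inl r, Inl q :: 'f + 'l} = {Inl i, Inl j}) in edge_term i j M) = edge_term r q M"
proof -
  let ?P = "\<lambda>(i, j). {Inl r, Inl q :: 'f + 'l} = {Inl i, Inl j}"
  have "?P (SOME p. ?P p)"
    by (rule someI[of ?P "(r, q)"]) simp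
  moreover obtain i j where ij: "(SOME p. ?P p) = (i, j)"
    by (cases "SOME p. ?P p")
  ultimately have "(i = r \<and> j = q) \<or> (i = q \<and> j = r)"
    by (auto simp: doubleton_eq_iff)
  then show ?thesis
    unfolding ij using edge_term_commute by auto
qed

lemma follower_edgeE:
  assumes "e \<in> follower_edges E"
  obtains i j where "e = {Inl i, Inl j}" "i \<noteq> j"
proof -
  have "card e = 2" "e \<subseteq> range Inl"
    using assms simple by (auto simp: follower_edges_def)
  then obtain x y where "e = {x, y}" "x \<noteq> y" "{x, y} \<subseteq> range Inl"
    by (metis card_2_iff)
  then show ?thesis
    using that by (metis image_iff insert_subset)
qed

section \<open>Symmetry, row action and positive definiteness of the Laplacian\<close>

lemma transpose_dirichlet_laplacian:
  "transpose (dirichlet_laplacian E W) = dirichlet_laplacian E W"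
proof -
  have "transpose (let (i, j) = (SOME (i, j). e = {Inl i, Inl j}) in edge_term i j (W e))
      = (let (i, j) = (SOME (i, j). e = {Inl i, Inl j}) in edge_term i j (W e))"
    if "e \<in> follower_edges E" for e
    using weights[of e] that
    by (simp add: Let_def transpose_edge_term spd_def follower_edges_def split: prod.split)
  moreover have "transpose (W {Inl i, Inr (leader_of E i)}) = W {Inl i, Inr (leader_of E i)}"
    if "i \<in> source_nodes E" for i
    using that weights leader_of_eqI unfolding source_nodes_def spd_def by auto
  ultimately have "transpose (\<Sum>e\<in>follower_edges E. let (i, j) = (SOME (i, j). e = {Inl i, Inl j}) in edge_term i j (W e))
      = (\<Sum>e\<in>follower_edges E. let (i, j) = (SOME (i, j). e = {Inl i, Inl j}) in edge_term i j (W e))"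
    "transpose (\<Sum>i\<in>source_nodes E. blk i ** W {Inl i, Inr (leader_of E i)} ** transpose (blk i))
      = (\<Sum>i\<in>source_nodes E. blk i ** W {Inl i, Inr (leader_of E i)} ** transpose (blk i))"
    by (simp_all add: transpose_sum matrix_transpose_mul matrix_mul_assoc)
  moreover have "transpose (M + N) = transpose M + transpose N" for M N :: "real^('f \<times> 'k)^('f \<times> 'k)"
    by (simp add: vec_eq_iff transpose_def)
  ultimately show ?thesis
    by (simp add: dirichlet_laplacian_def)
qed

text \<open>Kirchhoff form of the Laplacian: its block row at \<open>r\<close> is the net current
  leaving \<open>r\<close>. Both positivity and the effective resistance rest on it.\<close>

lemma dirichlet_laplacian_mult_vec:
  "(dirichlet_laplacian E W *v x) $ (r, a)
    = (\<Sum>q | {Inl r, q} \<in> E. W {Inl r, q} *v (potential x (Inl r :: 'f + 'l) - potential x q)) $ a"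
proof -
  let ?h = "\<lambda>e. let (i, j) = (SOME (i, j). e = {Inl i, Inl j}) in edge_term i j (W e)"
  let ?F = "\<lambda>q. (W {Inl r, q} *v (potential x (Inl r :: 'f + 'l) - potential x q)) $ a"
  let ?f = "\<lambda>q. {Inl r, Inl q :: 'f + 'l}"
  \<comment> \<open>An edge that misses \<open>r\<close> contributes nothing to block
    \<open>r\<close>, so only the edges from \<open>r\<close> to follower neighbours
    survive.\<close>
  have "(\<Sum>e\<in>follower_edges E. (?h e *v x) $ (r, a))
    = (\<Sum>e\<in>?f ` {q. ?f q \<in> E}. (?h e *v x) $ (r, a))"
  proof (rule sum.mono_neutral_right)
    show "?f ` {q. ?f q \<in> E} \<subseteq> follower_edges E"
      by (auto simp: follower_edges_def)
    show "\<forall>e\<in>follower_edges E - ?f ` {q. ?f q \<in> E}. (?h e *v x) $ (r, a) = 0"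
    proof
      fix e assume e: "e \<in> follower_edges E - ?f ` {q. ?f q \<in> E}"
      then have "e \<in> E" by (simp add: follower_edges_def)
      obtain i j where ij: "e = {Inl i, Inl j}" "i \<noteq> j"
        using e by (meson DiffD1 follower_edgeE)
      have "e \<noteq> ?f q" for q
        using e \<open>e \<in> E\<close> by blast
      then have "r \<noteq> i" "r \<noteq> j"
        unfolding ij(1) using insert_commute by metis+
      moreover have "?h e = edge_term i j (W e)"
        using edge_choice[of i j] \<open>e \<in> E\<close> unfolding ij(1) by simp
      ultimately show "(?h e *v x) $ (r, a) = 0"
        by (simp add: edge_term_mult_vec matrix_vector_mult_diff_rdistrib blk_mult_vec_nth)
    qed
  qed simp
  also have "\<dots> = (\<Sum>q | ?f q \<in> E. (?h (?f q) *v x) $ (r, a))"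
    by (rule sum.reindex[unfolded comp_def]) (auto simp: inj_on_def doubleton_eq_iff)
  also have "\<dots> = (\<Sum>q | ?f q \<in> E. ?F (Inl q))"
  proof (intro sum.cong refl)
    fix q assume "q \<in> {q. ?f q \<in> E}"
    then have "?h (?f q) = edge_term r q (W (?f q))" "r \<noteq> q"
      using edge_choice[of r q] edge_neq by auto
    then show "(?h (?f q) *v x) $ (r, a) = ?F (Inl q)"
      by (simp add: edge_term_mult_vec matrix_vector_mult_diff_rdistrib blk_mult_vec_nth)
  qed
  finally have followers: "(\<Sum>e\<in>follower_edges E. (?h e *v x) $ (r, a)) = (\<Sum>q | ?f q \<in> E. ?F (Inl q))" .
  have "(\<Sum>i\<in>source_nodes E. (blk i ** W {Inl i, Inr (leader_of E i)} ** transpose (blk i) *v x) $ (r, a))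
    = (\<Sum>i\<in>source_nodes E. if r = i then ?F (Inr (leader_of E r)) else 0)"
    by (intro sum.cong refl)
       (auto simp: blk_mult_vec_nth transpose_blk_mult_vec simp flip: matrix_vector_mul_assoc simp del: transpose_matrix_vector)
  \<comment> \<open>A follower has at most one leader neighbour, and has one exactly when it is a
    source node; both sums thus have the same single term or none.\<close>
  also have "\<dots> = (\<Sum>l | {Inl r, Inr l} \<in> E. ?F (Inr l))"
  proof (cases "r \<in> source_nodes E")
    case True
    then obtain l where "{Inl r, Inr l} \<in> E" unfolding source_nodes_def by blast
    then have "{l. {Inl r, Inr l} \<in> E} = {leader_of E r}"
      using leader_of_eqI by blast
    then show ?thesis using True by simp
  next
    case False
    then have "{l. {Inl r, Inr l} \<in> E} = {}" unfolding source_nodes_def by blast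
    then show ?thesis using False by simp
  qed
  finally have leaders: "(\<Sum>i\<in>source_nodes E. (blk i ** W {Inl i, Inr (leader_of E i)} ** transpose (blk i) *v x) $ (r, a))
    = (\<Sum>l | {Inl r, Inr l} \<in> E. ?F (Inr l))" .
  have split: "{q. {Inl r, q} \<in> E} = {q. ?f q \<in> E} <+> {l. {Inl r, Inr l} \<in> E}"
  proof (rule set_eqI)
    fix q show "q \<in> {q. {Inl r, q} \<in> E} \<longleftrightarrow> q \<in> {q. ?f q \<in> E} <+> {l. {Inl r, Inr l} \<in> E}"
      by (cases q) auto
  qed
  have "(\<Sum>q | {Inl r, q} \<in> E. ?F q)
      = (\<Sum>q | ?f q \<in> E. ?F (Inl q)) + (\<Sum>l | {Inl r, Inr l} \<in> E. ?F (Inr l))"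
    unfolding split by (subst sum.Plus) simp_all
  moreover have "(dirichlet_laplacian E W *v x) $ (r, a)
      = (\<Sum>e\<in>follower_edges E. (?h e *v x) $ (r, a))
      + (\<Sum>i\<in>source_nodes E. (blk i ** W {Inl i, Inr (leader_of E i)} ** transpose (blk i) *v x) $ (r, a))"
    unfolding dirichlet_laplacian_def
    by (simp only: matrix_vector_mult_add_rdistrib sum_matrix_vector_mult vector_add_component sum_component)
  ultimately show ?thesis
    unfolding followers leaders by (simp only: sum_component)
qed

lemma dirichlet_laplacian_pos:
  fixes x :: "real^('f \<times> 'k)"
  assumes "x \<noteq> 0"
  shows "0 < x \<bullet> (dirichlet_laplacian E W *v x)"
proof (rule ccontr)
  assume neg: "\<not> 0 < x \<bullet> (dirichlet_laplacian E W *v x)"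
  define V :: "'f + 'l \<Rightarrow> real^'k" where "V = potential x"
  \<comment> \<open>Non-edges get the value 0 so that all sums run over \<open>UNIV\<close> and can
    be swapped freely. \<open>d\<close> is the symmetrisation of \<open>g\<close>: the energy of an
    edge.\<close>
  define g where "g p q = (if {p, q} \<in> E then V p \<bullet> (W {p, q} *v (V p - V q)) else 0)" for p q
  define d where "d p q = (if {p, q} \<in> E then (V p - V q) \<bullet> (W {p, q} *v (V p - V q)) else 0)" for p q
  \<comment> \<open>Since leader rows vanish, the sum over followers extends to all nodes, giving
    both indices the same range.\<close>
  have g_Inr: "g (Inr l) q = 0" for l q
    by (simp add: g_def V_def)
  have "x \<bullet> (dirichlet_laplacian E W *v x)
      = (\<Sum>r\<in>UNIV. V (Inl r) \<bullet> (\<Sum>q | {Inl r, q} \<in> E. W {Inl r, q} *v (V (Inl r) - V q)))"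
    unfolding V_def by (simp only: inner_vec_def sum_pair_UNIV dirichlet_laplacian_mult_vec) simp
  also have "\<dots> = (\<Sum>r\<in>UNIV. \<Sum>q\<in>UNIV. g (Inl r) q)"
    unfolding g_def inner_sum_right by (simp add: sum.inter_filter[symmetric])
  also have "\<dots> = (\<Sum>p\<in>UNIV. \<Sum>q\<in>UNIV. g p q)"
    using sum.Plus[of UNIV UNIV "\<lambda>p. \<Sum>q\<in>UNIV. g p q"] by (simp add: g_Inr)
  finally have "2 * (x \<bullet> (dirichlet_laplacian E W *v x)) = (\<Sum>p\<in>UNIV. \<Sum>q\<in>UNIV. g p q) + (\<Sum>p\<in>UNIV. \<Sum>q\<in>UNIV. g q p)"
    by (subst (2) sum.swap) simp
  also have "\<dots> = (\<Sum>p\<in>UNIV. \<Sum>q\<in>UNIV. d p q)"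
    unfolding sum.distrib[symmetric]
  proof (intro sum.cong refl)
    fix p q
    show "g p q + g q p = d p q"
      using matrix_vector_mult_diff_distrib[of "W {p, q}" "V p" "V q"]
        matrix_vector_mult_diff_distrib[of "W {p, q}" "V q" "V p"]
      by (simp add: g_def d_def insert_commute[of q] inner_diff_left inner_diff_right)
  qed
  finally have sum: "(\<Sum>p\<in>UNIV. \<Sum>q\<in>UNIV. d p q) \<le> 0"
    using neg by simp
  have d_nonneg: "0 \<le> d p q" for p q
    using weights[of "{p, q}"] unfolding d_def spd_def
    by (cases "V p - V q = 0") (auto intro: less_imp_le)
  have "d p q = 0" for p q
  proof -
    have "d p q \<le> (\<Sum>q\<in>UNIV. d p q)"
      by (rule member_le_sum) (auto simp: d_nonneg)
    also have "\<dots> \<le> (\<Sum>p\<in>UNIV. \<Sum>q\<in>UNIV. d p q)"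
      by (rule member_le_sum[of p UNIV "\<lambda>p. \<Sum>q\<in>UNIV. d p q"]) (auto intro: sum_nonneg d_nonneg)
    finally show ?thesis using sum d_nonneg[of p q] by simp
  qed
  then have step: "V p = V q" if "{p, q} \<in> E" for p q
    using that weights[OF that] unfolding d_def spd_def by (metis eq_iff_diff_eq_0 less_irrefl)
  have const: "V p = V q" for p q
  proof -
    have "(p, q) \<in> {(p, q). {p, q} \<in> E}\<^sup>*"
      using connected by (simp add: connected_graph_def)
    then show ?thesis
      by (induction rule: rtrancl_induct) (use step in auto)
  qed
  \<comment> \<open>The type of leaders is inhabited, so some grounded node exists and fixes the
    constant at 0.\<close>
  have "V (Inl i) = 0" for i
    using const[of "Inl i" "Inr undefined"] by (simp add: V_def)
  then have "x = 0"
    by (simp add: V_def vec_eq_iff)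
  with assms show False by simp
qed

lemma dirichlet_laplacian_inverse:
  "dirichlet_laplacian E W ** matrix_inv (dirichlet_laplacian E W) = mat 1"
  "matrix_inv (dirichlet_laplacian E W) ** dirichlet_laplacian E W = mat 1"
  by (rule spd_invertible, simp add: spd_def transpose_dirichlet_laplacian dirichlet_laplacian_pos)+

text \<open>Column by column this is the vector case: as \<open>V\<close> vanishes at the leaders,
  each of its columns is the zero extension of its follower part.\<close>

lemma dirichlet_laplacian_mult:
  fixes V :: "'f + 'l \<Rightarrow> real^'k^'k"
  assumes "\<And>l. V (Inr l) = 0"
  shows "(dirichlet_laplacian E W ** (\<chi> p. V (Inl (fst p)) $ snd p)) $ (r, a)
    = (\<Sum>q | {Inl r, q} \<in> E. W {Inl r, q} ** (V (Inl r) - V q)) $ a"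
proof -
  have "(dirichlet_laplacian E W ** (\<chi> p. V (Inl (fst p)) $ snd p)) $ (r, a) $ c
    = (\<Sum>q | {Inl r, q} \<in> E. W {Inl r, q} ** (V (Inl r) - V q)) $ a $ c" for c
  proof -
    let ?x = "\<chi> p. V (Inl (fst p)) $ snd p $ c"
    have pot: "potential ?x p = (\<chi> b. V p $ b $ c)" for p
      using assms by (cases p) (auto simp: vec_eq_iff)
    have "(dirichlet_laplacian E W ** (\<chi> p. V (Inl (fst p)) $ snd p)) $ (r, a) $ c
      = (dirichlet_laplacian E W *v ?x) $ (r, a)"
      by (simp add: matrix_matrix_mult_def matrix_vector_mult_def)
    also have "\<dots> = (\<Sum>q | {Inl r, q} \<in> E. (W {Inl r, q} ** (V (Inl r) - V q)) $ a $ c)"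
      unfolding dirichlet_laplacian_mult_vec pot
      by (simp add: matrix_matrix_mult_def matrix_vector_mult_def)
    finally show ?thesis by simp
  qed
  then show ?thesis by (simp add: vec_eq_iff)
qed

subsection \<open>Effective resistance and trace\<close>

text \<open>Ohm's and Kirchhoff's laws amount to one linear system for the stacked follower
  potentials, with right-hand side \<open>blk s ** c\<close>. Solving it gives existence of a flow,
  and invertibility gives uniqueness of the potentials; the definite description needs both.\<close>

lemma effective_resistance_eq:
  "effective_resistance E W s = diag_block s (matrix_inv (dirichlet_laplacian E W) ** blk s)"
proof -
  let ?A = "dirichlet_laplacian E W"
  let ?R = "diag_block s (matrix_inv ?A ** blk s)"
  have diag: "diag_block s (matrix_inv ?A ** (blk s ** c)) = ?R ** c" for c :: "real^'k^'k"
    by (simp add: matrix_mul_assoc) (simp add: diag_block_def matrix_matrix_mult_def vec_eq_iff)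
  have ex: "\<exists>V I. electrical_flow E W s c V I" for c
  proof -
    define X where "X = matrix_inv ?A ** (blk s ** c)"
    define V :: "'f + 'l \<Rightarrow> real^'k^'k" where "V = case_sum (\<lambda>i. \<chi> a. X $ (i, a)) (\<lambda>_. 0)"
    define I where "I p q = W {p, q} ** (V p - V q)" for p q
    have "(\<chi> p. V (Inl (fst p)) $ snd p) = X"
      by (simp add: V_def vec_eq_iff)
    moreover have "?A ** X = blk s ** c"
      unfolding X_def by (simp add: matrix_mul_assoc dirichlet_laplacian_inverse)
    ultimately have "(\<Sum>q | {Inl r, q} \<in> E. I (Inl r) q) $ a $ b = (blk s ** c) $ (r, a) $ b" for r a b
      using dirichlet_laplacian_mult[of V r a] unfolding I_def by (simp add: V_def)
    then have "(\<Sum>q | {Inl r, q} \<in> E. I (Inl r) q) = (if r = s then c else 0)" for r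
      by (simp add: vec_eq_iff blk_mult_nth)
    moreover have "matrix_inv (W {p, q}) ** I p q = V p - V q" if "{p, q} \<in> E" for p q
      unfolding I_def by (simp add: matrix_mul_assoc spd_invertible weights that)
    ultimately have "electrical_flow E W s c V I"
      by (simp add: electrical_flow_def V_def)
    then show ?thesis by blast
  qed
  have unique: "V (Inl s) = ?R ** c" if "electrical_flow E W s c V I" for c V I
  proof -
    have V0: "V (Inr l) = 0" for l
      using that by (simp add: electrical_flow_def)
    \<comment> \<open>Inverting the resistance eliminates the currents and leaves equations in the
      potentials alone.\<close>
    have ohm: "I p q = W {p, q} ** (V p - V q)" if "{p, q} \<in> E" for p q
    proof -
      have "matrix_inv (W {p, q}) ** I p q = V p - V q"
        using \<open>electrical_flow E W s c V I\<close> that by (simp add: electrical_flow_def)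
      then have "W {p, q} ** (V p - V q) = (W {p, q} ** matrix_inv (W {p, q})) ** I p q"
        by (metis matrix_mul_assoc)
      then show ?thesis
        by (simp add: spd_invertible weights that)
    qed
    define X where "X = (\<chi> p. V (Inl (fst p)) $ snd p)"
    have "(\<Sum>q | {Inl r, q} \<in> E. W {Inl r, q} ** (V (Inl r) - V q)) = (if r = s then c else 0)" for r
    proof -
      have "(\<Sum>q | {Inl r, q} \<in> E. I (Inl r) q) = (if r = s then c else 0)"
        using that by (simp add: electrical_flow_def)
      moreover have "(\<Sum>q | {Inl r, q} \<in> E. W {Inl r, q} ** (V (Inl r) - V q)) = (\<Sum>q | {Inl r, q} \<in> E. I (Inl r) q)"
        by (intro sum.cong refl) (simp add: ohm)
      ultimately show ?thesis by simp
    qed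
    then have "(?A ** X) $ p = (blk s ** c) $ p" for p
      using dirichlet_laplacian_mult[of V, OF V0] unfolding X_def
      by (cases p) (auto simp: vec_eq_iff blk_mult_nth)
    then have "?A ** X = blk s ** c"
      by (simp add: vec_eq_iff)
    then have "matrix_inv ?A ** (blk s ** c) = (matrix_inv ?A ** ?A) ** X"
      by (metis matrix_mul_assoc)
    then have "matrix_inv ?A ** (blk s ** c) = X"
      by (simp add: dirichlet_laplacian_inverse)
    then have "?R ** c = diag_block s X"
      using diag by metis
    then show ?thesis
      by (simp add: X_def diag_block_def vec_eq_iff)
  qed
  show ?thesis
    unfolding effective_resistance_def
  proof (rule the_equality)
    show "\<forall>c. (\<exists>V I. electrical_flow E W s c V I) \<and> (\<forall>V I. electrical_flow E W s c V I \<longrightarrow> V (Inl s) = ?R ** c)"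
      using ex unique by blast
    fix \<rho> assume rho: "\<forall>c. (\<exists>V I. electrical_flow E W s c V I) \<and> (\<forall>V I. electrical_flow E W s c V I \<longrightarrow> V (Inl s) = \<rho> ** c)"
    \<comment> \<open>The identity current suffices to determine \<rho>, since
      \<open>\<rho> ** mat 1 = \<rho>\<close>.\<close>
    obtain V I where "electrical_flow E W s (mat 1) V I"
      using ex by blast
    then have "\<rho> ** mat 1 = ?R ** mat 1"
      using rho unique by metis
    then show "\<rho> = ?R" by simp
  qed
qed

text \<open>Each diagonal entry of the product is the diagonal entry of \<open>M\<close> at the
  source node of the corresponding leader; the bijection between leaders and source nodes then
  reindexes the trace.\<close>

lemma trace_input_matrix:
  "trace (transpose (input_matrix E :: real^('l \<times> 'k)^('f \<times> 'k)) ** M ** input_matrix E)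
    = (\<Sum>s\<in>source_nodes E. trace (diag_block s (M ** blk s)))"
proof -
  let ?B = "input_matrix E :: real^('l \<times> 'k)^('f \<times> 'k)"
  have col: "?B $ p $ (l, c) = blk (source_of E l) $ p $ c" for p l c
    by (simp add: input_matrix_def)
  have "(transpose ?B ** M ** ?B) $ (l, c) $ (l, c) = M $ (source_of E l, c) $ (source_of E l, c)" for l c
  proof -
    let ?b = "blk (source_of E l) :: real^'k^('f \<times> 'k)"
    have "(transpose ?B ** M ** ?B) $ (l, c) $ (l, c) = (transpose ?b ** M ** ?b) $ c $ c"
      by (simp add: matrix_matrix_mult_def transpose_def col)
    \<comment> \<open>Multiplication by \<open>?b\<close> on the right selects columns; transposing
      reduces the selection of rows to the same rule.\<close>
    also have "\<dots> = transpose (transpose M ** ?b) $ c $ (source_of E l, c)"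
      by (simp add: matrix_mult_blk_nth matrix_transpose_mul)
    also have "\<dots> = M $ (source_of E l, c) $ (source_of E l, c)"
      by (simp add: transpose_def[of "_ ** _"] matrix_mult_blk_nth) (simp add: transpose_def)
    finally show ?thesis .
  qed
  then have "trace (transpose ?B ** M ** ?B)
      = (\<Sum>l\<in>UNIV. \<Sum>c\<in>UNIV. M $ (source_of E l, c) $ (source_of E l, c))"
    by (simp add: trace_def sum_pair_UNIV)
  also have "\<dots> = (\<Sum>s\<in>source_nodes E. \<Sum>c\<in>UNIV. M $ (s, c) $ (s, c))"
    by (rule sum.reindex_bij_betw[OF bij_betw_source_of])
  finally show ?thesis
    by (simp add: trace_def diag_block_def matrix_mult_blk_nth)
qed

end

theorem lemma1:
  fixes E :: "('f::finite + 'l::finite) set set"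
    and W :: "('f + 'l) set \<Rightarrow> real^'k::finite^'k"
  assumes "leader_follower E W"
  shows "(h2_norm (- dirichlet_laplacian E W)
                  (input_matrix E :: real^('l \<times> 'k)^('f \<times> 'k))
                  (mat 1 :: real^('f \<times> 'k)^('f \<times> 'k)))\<^sup>2
           = 1 / 2 * (\<Sum>s\<in>source_nodes E.
               trace (diag_block s (matrix_inv (dirichlet_laplacian E W) ** blk s)))
       \<and> 1 / 2 * (\<Sum>s\<in>source_nodes E.
               trace (diag_block s (matrix_inv (dirichlet_laplacian E W) ** blk s)))
           = 1 / 2 * (\<Sum>s\<in>source_nodes E. trace (effective_resistance E W s))"
proof -
  interpret leader_follower E W by fact
  show ?thesis
    by (simp only: effective_resistance_eq trace_input_matrix simp_thms
        h2_norm_symmetric[OF transpose_dirichlet_laplacian dirichlet_laplacian_pos])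
qed

end
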